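(* The bilinear maps $\phi_1,\phi_2:\mathrm{Der}_{\mathbb C}(R)\times\mathrm{Der}_{\mathbb C}(R)\to\mathbb C$ defined in the context are linearly independent $2$-cocycles on the Lie algebra $\mathrm{Der}_{\mathbb C}(R)$ (with values in the trivial module $\mathbb C$), and for each $i=1,2$ the cocycle $\phi_i$ is not a $2$-coboundary.
   Context: Let $R=\mathbb C[t,t^{-1},u\mid u^2=t^2+4t]$ and $D=(t+2)\frac{\partial}{\partial u}+u\frac{\partial}{\partial t}$. The Lie algebra $\mathrm{Der}_{\mathbb C}(R)$ (the 3-point Witt algebra) has basis $d_n=t^nuD$, $d^1_n=t^nD$, $n\in\mathbb Z$. Define $\phi_1$ bilinearly by, for all $k,l\in\mathbb Z$, \begin{align*} \phi_1(d^1_k,d^1_l)&=2(l^2-l)(2l-1)\delta_{k+l,1}+(l^3-l)\delta_{k+l,0},\\ \phi_1(d^1_k,d_l)&=6(-1)^{k+l}2^{k+l}(k-1)kl\,\frac{(2k+2l-3)!!}{(k+l+1)!},\qquad \phi_1(d_l,d^1_k)=-\phi_1(d^1_k,d_l),\\ \phi_1(d_k,d_l)&=l(l+1)(l+2)\delta_{k+l,-2}+4l(2l+1)(l+1)\delta_{k+l,-1}+4l(2l-1)(2l+1)\delta_{k+l,0}, \end{align*} and $\phi_2$ bilinearly by $\phi_2(d^1_k,d^1_l)=-2\phi_1(d^1_k,d^1_l)$, $\phi_2(d_k,d_l)=-2\phi_1(d_k,d_l)$, $\phi_2(d^1_k,d_l)=\phi_2(d_l,d^1_k)=0$. Conventions: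 $1/n!=0$ for negative integers $n$, and the double factorial of odd integers is extended to negative odd integers by $n!!=n\,(n-2)!!$, so $(-1)!!=1$, $(-3)!!=-1$, $(-5)!!=1/3$. A $2$-cocycle is a skew-symmetric bilinear form $\phi$ with $\phi([a,b],c)+\phi([b,c],a)+\phi([c,a],b)=0$ for all $a,b,c$; a $2$-coboundary is a form $(a,b)\mapsto f([a,b])$ with $f$ a linear functional. *)

theory Defs
  imports Complex_Main "HOL-Library.Poly_Mapping" "HOL-Computational_Algebra.Polynomial"
begin

section \<open>Two-cocycles of Lie algebras with trivial coefficients\<close>

locale lie_algebra = vector_space scale
  for scale :: "'k::field \<Rightarrow> 'g::ab_group_add \<Rightarrow> 'g" +
  fixes bracket :: "'g \<Rightarrow> 'g \<Rightarrow> 'g"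
  assumes bracket_linear_left: "Vector_Spaces.linear scale scale (\<lambda>x. bracket x y)"
    and bracket_linear_right: "Vector_Spaces.linear scale scale (bracket x)"
    and bracket_self: "bracket x x = 0"
    and jacobi: "bracket x (bracket y z) + bracket y (bracket z x) + bracket z (bracket x y) = 0"
begin

definition bilinear_form :: "('g \<Rightarrow> 'g \<Rightarrow> 'k) \<Rightarrow> bool" where
  "bilinear_form \<phi> \<longleftrightarrow>
     (\<forall>x. Vector_Spaces.linear scale (*) (\<phi> x)) \<and>
     (\<forall>y. Vector_Spaces.linear scale (*) (\<lambda>x. \<phi> x y))"

definition two_cocycle :: "('g \<Rightarrow> 'g \<Rightarrow> 'k) \<Rightarrow> bool" where
  "two_cocycle \<phi> \<longleftrightarrow> bilinear_form \<phi> \<and> (\<forall>a b. \<phi> a b = - \<phi> b a) \<and>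
     (\<forall>a b c. \<phi> (bracket a b) c + \<phi> (bracket b c) a + \<phi> (bracket c a) b = 0)"

definition two_coboundary :: "('g \<Rightarrow> 'g \<Rightarrow> 'k) \<Rightarrow> bool" where
  "two_coboundary \<phi> \<longleftrightarrow>
     (\<exists>f. Vector_Spaces.linear scale (*) f \<and> \<phi> = (\<lambda>a b. f (bracket a b)))"

end


section \<open>The ring \<open>R = \<complex>[t, t\<^sup>-\<^sup>1, u | u\<^sup>2 = t\<^sup>2 + 4t]\<close>\<close>

text \<open>Laurent polynomials in \<open>t\<close> are the group algebra of the integers, i.e. finitely supported
  functions with convolution product; \<open>Poly_Mapping.single n c\<close> is \<open>c t\<^sup>n\<close>.\<close>

type_synonym laurent = "int \<Rightarrow>\<^sub>0 complex"

abbreviation lmonom :: "int \<Rightarrow> complex \<Rightarrow> laurent" where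
  "lmonom \<equiv> Poly_Mapping.single"

text \<open>\<open>R\<close> is the quotient of \<open>\<complex>[t, t\<^sup>-\<^sup>1][u]\<close> by the ideal generated by \<open>u\<^sup>2 - (t\<^sup>2 + 4t)\<close>.\<close>

definition u_relation :: "laurent poly" where
  "u_relation = [: - (lmonom 2 1 + lmonom 1 4), 0, 1 :]"

definition R_rel :: "laurent poly \<Rightarrow> laurent poly \<Rightarrow> bool" where
  "R_rel p q \<longleftrightarrow> u_relation dvd p - q"

lemma equivp_R_rel: "equivp R_rel"
proof (rule equivpI)
  show "reflp R_rel" by (simp add: reflp_def R_rel_def)
  show "symp R_rel"
    by (rule sympI) (metis R_rel_def dvd_minus_iff minus_diff_eq)
  show "transp R_rel"
  proof (rule transpI)
    fix p q r assume "R_rel p q" "R_rel q r"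
    then have "u_relation dvd (p - q) + (q - r)" unfolding R_rel_def by (rule dvd_add)
    then show "R_rel p r" by (simp add: R_rel_def)
  qed
qed

lemma u_relation_not_dvd_1: "\<not> u_relation dvd 1"
proof
  assume "u_relation dvd 1"
  then have "degree u_relation \<le> degree (1 :: laurent poly)" by (rule dvd_imp_degree_le) simp
  then show False by (simp add: u_relation_def)
qed

quotient_type R = "laurent poly" / R_rel
  by (rule equivp_R_rel)

instantiation R :: comm_ring_1
begin

lift_definition zero_R :: R is 0 .
lift_definition one_R :: R is 1 .
lift_definition plus_R :: "R \<Rightarrow> R \<Rightarrow> R" is "(+)"
  unfolding R_rel_def by (simp only: add_diff_add dvd_add)
lift_definition uminus_R :: "R \<Rightarrow> R" is uminus
  unfolding R_rel_def by (simp only: minus_diff_minus dvd_minus_iff)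
lift_definition minus_R :: "R \<Rightarrow> R \<Rightarrow> R" is "(-)"
proof -
  fix p p' q q' assume "R_rel p p'" "R_rel q q'"
  then have "u_relation dvd (p - p') - (q - q')" unfolding R_rel_def by (rule dvd_diff)
  then show "R_rel (p - q) (p' - q')" by (simp add: R_rel_def algebra_simps)
qed
lift_definition times_R :: "R \<Rightarrow> R \<Rightarrow> R" is "(*)"
  unfolding R_rel_def by (simp only: mult_diff_mult dvd_add dvd_mult dvd_mult2)

instance
proof
  show "(0::R) \<noteq> 1"
    by transfer (simp add: R_rel_def u_relation_not_dvd_1)
qed (transfer; simp add: R_rel_def algebra_simps)+

end

lift_definition scale_R :: "complex \<Rightarrow> R \<Rightarrow> R" is "\<lambda>c p. smult (lmonom 0 c) p"
  unfolding R_rel_def by (simp only: dvd_smult flip: smult_diff_right)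

interpretation R: vector_space scale_R
  by unfold_locales
    (transfer; simp add: R_rel_def smult_add_right smult_add_left single_add mult_single)+

text \<open>\<open>t_pow n\<close> is \<open>t\<^sup>n\<close> for \<open>n \<in> \<int>\<close>.\<close>

lift_definition t_pow :: "int \<Rightarrow> R" is "\<lambda>n. [: lmonom n 1 :]" .

lift_definition u :: R is "[: 0, 1 :]" .

abbreviation t :: R where "t \<equiv> t_pow 1"


section \<open>The derivation \<open>D\<close>\<close>

text \<open>\<open>\<partial>/\<partial>t\<close> on \<open>\<complex>[t, t\<^sup>-\<^sup>1]\<close>, described on coefficients.\<close>

lift_definition laurent_deriv :: "laurent \<Rightarrow> laurent" is "\<lambda>p n. of_int (n + 1) * p (n + 1)"
proof -
  fix p :: "int \<Rightarrow> complex" assume "finite {n. p n \<noteq> 0}"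
  then have "finite ((\<lambda>n. n - 1) ` {n. p n \<noteq> 0})" by simp
  then show "finite {n. of_int (n + 1) * p (n + 1) \<noteq> 0}"
    by (rule rev_finite_subset) (auto intro!: image_eqI[where x = "_ + 1"])
qed

lemma laurent_deriv_add: "laurent_deriv (p + q) = laurent_deriv p + laurent_deriv q"
  by transfer (simp add: algebra_simps)

lemma laurent_deriv_0 [simp]: "laurent_deriv 0 = 0"
  by transfer simp

lemma laurent_deriv_single:
  "laurent_deriv (lmonom n c) = lmonom (n - 1) (of_int n * c)"
  by (rule poly_mapping_eqI) (auto simp: laurent_deriv.rep_eq lookup_single when_def)

lemma laurent_deriv_minus: "laurent_deriv (p - q) = laurent_deriv p - laurent_deriv q"
  by (metis laurent_deriv_add add_diff_cancel_right' diff_add_cancel)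

lemma laurent_deriv_1 [simp]: "laurent_deriv 1 = 0"
  using laurent_deriv_single[of 0 1] by simp

lemma poly_mapping_add_induct [case_names zero single add]:
  fixes p :: "'a \<Rightarrow>\<^sub>0 'b::comm_monoid_add"
  assumes "P 0" "\<And>k c. P (Poly_Mapping.single k c)" "\<And>f g. P f \<Longrightarrow> P g \<Longrightarrow> P (f + g)"
  shows "P p"
proof (induction p rule: update_induct)
  case const
  then show ?case using assms(1) .
next
  case (update f a b)
  have "Poly_Mapping.update a b f = f + Poly_Mapping.single a b"
    using update by (intro poly_mapping_eqI)
      (auto simp: lookup_update lookup_add lookup_single when_def in_keys_iff)
  then show ?case using assms update by simp
qed

lemma laurent_deriv_mult:
  "laurent_deriv (p * q) = p * laurent_deriv q + q * laurent_deriv p"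
proof (induction p rule: poly_mapping_add_induct)
  case zero show ?case by simp
next
  case (single k c)
  show ?case
  proof (induction q rule: poly_mapping_add_induct)
    case zero show ?case by simp
  next
    case (single l d)
    show ?case
      by (simp add: laurent_deriv_single mult_single algebra_simps flip: single_add)
  next
    case (add f g)
    then show ?case by (simp add: laurent_deriv_add algebra_simps)
  qed
next
  case (add f g)
  then show ?case by (simp add: laurent_deriv_add algebra_simps)
qed

text \<open>The derivation \<open>(t + 2) \<partial>/\<partial>u + u \<partial>/\<partial>t\<close> of \<open>\<complex>[t, t\<^sup>-\<^sup>1][u]\<close>. It maps \<open>u\<^sup>2 - t\<^sup>2 - 4t\<close> to \<open>0\<close>
  and hence descends to \<open>R\<close>.\<close>

definition D_poly :: "laurent poly \<Rightarrow> laurent poly" where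
  "D_poly p = [: lmonom 1 1 + lmonom 0 2 :] * pderiv p + [: 0, 1 :] * map_poly laurent_deriv p"

lemma map_poly_laurent_deriv_add:
  "map_poly laurent_deriv (p + q) = map_poly laurent_deriv p + map_poly laurent_deriv q"
  by (rule poly_eqI) (simp add: coeff_map_poly laurent_deriv_add)

lemma map_poly_laurent_deriv_smult:
  "map_poly laurent_deriv (smult a p) = smult a (map_poly laurent_deriv p) + smult (laurent_deriv a) p"
  by (rule poly_eqI) (simp add: coeff_map_poly laurent_deriv_mult)

lemma map_poly_laurent_deriv_mult:
  "map_poly laurent_deriv (p * q) = p * map_poly laurent_deriv q + q * map_poly laurent_deriv p"
  by (induction p)
    (simp_all add: map_poly_laurent_deriv_add map_poly_laurent_deriv_smult map_poly_pCons algebra_simps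
      smult_add_right)

lemma D_poly_add: "D_poly (p + q) = D_poly p + D_poly q"
  by (simp add: D_poly_def pderiv_add map_poly_laurent_deriv_add algebra_simps smult_add_right)

lemma D_poly_mult: "D_poly (p * q) = p * D_poly q + q * D_poly p"
  unfolding D_poly_def pderiv_mult map_poly_laurent_deriv_mult by (simp only: algebra_simps)

lemma D_poly_u_relation: "D_poly u_relation = 0"
proof -
  define c where "c = - (lmonom 2 1 + lmonom 1 4)"
  have "laurent_deriv c = - lmonom 1 2 - lmonom 0 4"
    using laurent_deriv_minus[of 0 "lmonom 2 1 + lmonom 1 4"]
    by (simp add: c_def laurent_deriv_add laurent_deriv_single del: single_numeral)
  moreover have "2 * lmonom 1 1 = lmonom 1 2"
    by (metis mult_2 single_add one_add_one)
  ultimately have c: "laurent_deriv c = - ((lmonom 1 1 + lmonom 0 2) * 2)"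
    by (simp add: distrib_right mult.commute[of "lmonom 1 1"])
  have "D_poly [: c, 0, 1 :] = 0"
    by (simp add: D_poly_def pderiv_pCons map_poly_pCons c del: single_numeral)
  then show ?thesis by (simp add: u_relation_def c_def)
qed

lemma D_poly_minus: "D_poly (p - q) = D_poly p - D_poly q"
  by (metis D_poly_add add_diff_cancel_right' diff_add_cancel)

lift_definition D :: "R \<Rightarrow> R" is D_poly
proof -
  fix p q assume "R_rel p q"
  then obtain r where "p - q = u_relation * r" by (auto simp: R_rel_def)
  then have "D_poly p - D_poly q = u_relation * D_poly r"
    by (metis D_poly_minus D_poly_mult D_poly_u_relation add.right_neutral mult_zero_right)
  then show "R_rel (D_poly p) (D_poly q)" by (simp add: R_rel_def)
qed


section \<open>The Lie algebra of derivations\<close>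

definition derivation :: "(R \<Rightarrow> R) \<Rightarrow> bool" where
  "derivation \<delta> \<longleftrightarrow> Vector_Spaces.linear scale_R scale_R \<delta> \<and>
     (\<forall>x y. \<delta> (x * y) = x * \<delta> y + y * \<delta> x)"

typedef Der = "{\<delta>. derivation \<delta>}"
  morphisms apply_der Abs_Der
proof
  show "(\<lambda>_. 0) \<in> {\<delta>. derivation \<delta>}"
    by (simp add: derivation_def Vector_Spaces.linear_iff R.vector_space_axioms)
qed

setup_lifting type_definition_Der

lemma scale_R_mult_left: "scale_R c x * y = scale_R c (x * y)"
  by transfer (simp add: R_rel_def)

lemma scale_R_mult_right: "x * scale_R c y = scale_R c (x * y)"
  by transfer (simp add: R_rel_def)

lemma derivation_iff:
  "derivation \<delta> \<longleftrightarrow> (\<forall>x y. \<delta> (x + y) = \<delta> x + \<delta> y) \<and> (\<forall>c x. \<delta> (scale_R c x) = scale_R c (\<delta> x)) \<and>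
     (\<forall>x y. \<delta> (x * y) = x * \<delta> y + y * \<delta> x)"
  by (simp only: derivation_def Vector_Spaces.linear_iff R.vector_space_axioms simp_thms conj_assoc)

instantiation Der :: ab_group_add
begin

lift_definition zero_Der :: Der is "\<lambda>_. 0"
  by (simp add: derivation_iff)
lift_definition plus_Der :: "Der \<Rightarrow> Der \<Rightarrow> Der" is "\<lambda>\<delta> \<epsilon> x. \<delta> x + \<epsilon> x"
  by (simp add: derivation_iff algebra_simps R.scale_right_distrib)
lift_definition minus_Der :: "Der \<Rightarrow> Der \<Rightarrow> Der" is "\<lambda>\<delta> \<epsilon> x. \<delta> x - \<epsilon> x"
  by (simp add: derivation_iff algebra_simps R.scale_right_diff_distrib)
lift_definition uminus_Der :: "Der \<Rightarrow> Der" is "\<lambda>\<delta> x. - \<delta> x"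
  by (simp add: derivation_iff algebra_simps)

instance
  by standard (transfer; simp add: fun_eq_iff)+

end

lift_definition scale_Der :: "complex \<Rightarrow> Der \<Rightarrow> Der" is "\<lambda>c \<delta> x. scale_R c (\<delta> x)"
  by (simp add: derivation_iff R.scale_right_distrib scale_R_mult_right mult.commute)

lift_definition bracket_Der :: "Der \<Rightarrow> Der \<Rightarrow> Der" is "\<lambda>\<delta> \<epsilon> x. \<delta> (\<epsilon> x) - \<epsilon> (\<delta> x)"
  by (simp add: derivation_iff algebra_simps R.scale_right_diff_distrib)

lemma vector_space_Der: "vector_space scale_Der"
  by unfold_locales
    (transfer; simp add: fun_eq_iff R.scale_right_distrib R.scale_left_distrib)+

lemma derivation_diff: "derivation \<delta> \<Longrightarrow> \<delta> (x - y) = \<delta> x - \<delta> y"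
  by (metis add_diff_cancel_right' derivation_iff diff_add_cancel)

interpretation Der: lie_algebra scale_Der bracket_Der
proof (intro lie_algebra.intro lie_algebra_axioms.intro vector_space_Der)
  fix x y z
  show "Vector_Spaces.linear scale_Der scale_Der (\<lambda>x. bracket_Der x y)"
    unfolding Vector_Spaces.linear_iff
    by (intro conjI vector_space_Der allI; transfer)
      (auto simp: fun_eq_iff derivation_iff R.scale_right_diff_distrib)
  show "Vector_Spaces.linear scale_Der scale_Der (bracket_Der x)"
    unfolding Vector_Spaces.linear_iff
    by (intro conjI vector_space_Der allI; transfer)
      (auto simp: fun_eq_iff derivation_iff R.scale_right_diff_distrib)
  show "bracket_Der x x = 0"
    by transfer simp
  show "bracket_Der x (bracket_Der y z) + bracket_Der y (bracket_Der z x)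
      + bracket_Der z (bracket_Der x y) = 0"
    by transfer (simp add: fun_eq_iff derivation_diff)
qed

lemma derivation_mult_D: "derivation (\<lambda>x. f * D x)"
proof -
  have 1: "D (x + y) = D x + D y" for x y
    by transfer (simp add: D_poly_add R_rel_def)
  have 2: "D (x * y) = x * D y + y * D x" for x y
    by transfer (simp add: D_poly_mult R_rel_def)
  have 3: "D (scale_R c x) = scale_R c (D x)" for c x
  proof transfer
    fix c p
    have "map_poly laurent_deriv (smult (lmonom 0 c) p) = smult (lmonom 0 c) (map_poly laurent_deriv p)"
      by (simp add: map_poly_laurent_deriv_smult laurent_deriv_single)
    then show "R_rel (D_poly (smult (lmonom 0 c) p)) (smult (lmonom 0 c) (D_poly p))"
      by (simp add: R_rel_def D_poly_def pderiv_smult smult_add_right mult.commute)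
  qed
  show ?thesis
    by (simp add: derivation_iff 1 2 3 algebra_simps scale_R_mult_right)
qed

lift_definition mult_D :: "R \<Rightarrow> Der" is "\<lambda>f x. f * D x"
  by (simp add: derivation_mult_D)

text \<open>\<open>d n\<close> is \<open>t\<^sup>n u D\<close> and \<open>d1 n\<close> is \<open>t\<^sup>n D\<close>; the superscript of \<open>d\<^sup>1\<^sub>n\<close> is a label.\<close>

definition d :: "int \<Rightarrow> Der" where
  "d n = mult_D (t_pow n * u)"

definition d1 :: "int \<Rightarrow> Der" where
  "d1 n = mult_D (t_pow n)"


section \<open>The basis \<open>d\<^sub>n, d\<^sup>1\<^sub>n\<close> of \<open>Der(R)\<close>\<close>

lifting_forget poly_mapping.lifting

lift_definition of_laurent :: "laurent \<Rightarrow> R" is "\<lambda>p. [: p :]" .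

lemma of_laurent_simps:
  "of_laurent 0 = 0" "of_laurent 1 = 1"
  "of_laurent (p + q) = of_laurent p + of_laurent q"
  "of_laurent (p * q) = of_laurent p * of_laurent q"
  by (transfer; simp add: R_rel_def one_pCons)+

lemma of_laurent_single: "of_laurent (lmonom n c) = scale_R c (t_pow n)"
  by transfer (simp add: R_rel_def mult_single)

lemma of_laurent_scale: "of_laurent (lmonom 0 c * p) = scale_R c (of_laurent p)"
  by transfer (simp add: R_rel_def)

lemma of_laurent_numeral: "of_laurent (numeral n) = numeral n"
  by (induction n) (simp_all only: numeral.simps of_laurent_simps)

definition u_square :: laurent where
  "u_square = lmonom 2 1 + lmonom 1 4"

lemma u_mult_u: "u * u = of_laurent u_square"
  unfolding u_square_def by transfer (simp add: R_rel_def u_relation_def)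

lemma u_square_nonzero: "u_square \<noteq> 0"
proof -
  have "Poly_Mapping.lookup u_square (2::int) = 1" by (simp add: u_square_def lookup_add lookup_single when_def)
  then show ?thesis by auto
qed

lemma R_normal_form: "\<exists>p q. r = of_laurent p + of_laurent q * u"
proof -
  have "\<exists>p q. abs_R P = of_laurent p + of_laurent q * u" for P
  proof (induction P)
    case 0
    have "abs_R 0 = of_laurent 0 + of_laurent 0 * u"
      by (simp add: of_laurent_simps flip: zero_R.abs_eq)
    then show ?case by blast
  next
    case (pCons a P)
    then obtain p q where *: "abs_R P = of_laurent p + of_laurent q * u" by blast
    have "abs_R (pCons a P) = of_laurent a + u * abs_R P"
      by (simp add: of_laurent.abs_eq u.abs_eq times_R.abs_eq plus_R.abs_eq)
    also have "\<dots> = of_laurent (a + q * u_square) + of_laurent p * u"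
      by (simp add: * of_laurent_simps algebra_simps flip: u_mult_u)
    finally show ?case by blast
  qed
  from this[of "rep_R r"] show ?thesis
    by (simp only: Quotient_abs_rep[OF Quotient_R])
qed

lemma R_normal_form_zero:
  assumes "of_laurent p + of_laurent q * u = 0"
  shows "p = 0 \<and> q = 0"
proof -
  have "u_relation dvd [: p, q :]"
    using assms by transfer (simp add: R_rel_def)
  moreover have "degree [: p, q :] < degree u_relation"
    by (simp add: u_relation_def)
  ultimately have "[: p, q :] = 0"
    by (meson dvd_imp_degree_le leD)
  then show ?thesis by simp
qed

lemma of_laurent_minus: "of_laurent (p - q) = of_laurent p - of_laurent q"
  by transfer (simp add: R_rel_def)

lemma R_normal_form_unique:
  assumes "of_laurent p + of_laurent q * u = of_laurent p' + of_laurent q' * u"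
  shows "p = p' \<and> q = q'"
proof -
  have "of_laurent (p - p') + of_laurent (q - q') * u = 0"
    by (simp only: of_laurent_minus left_diff_distrib assms diff_self flip: add_diff_add)
  then show ?thesis using R_normal_form_zero[of "p - p'" "q - q'"] by simp
qed

lemma t_pow_eq: "t_pow n = of_laurent (lmonom n 1)"
  unfolding of_laurent_single by (rule R.scale_one[symmetric])

lemma t_pow_add: "t_pow (m + n) = t_pow m * t_pow n"
  unfolding t_pow_eq of_laurent_simps(4)[symmetric] mult_single by simp

lemma t_pow_0: "t_pow 0 = 1"
  unfolding t_pow_eq single_one of_laurent_simps ..

lemma D_u: "D u = t + 2"
proof -
  have "D u = of_laurent (lmonom 1 1 + 2)"
    by transfer (simp add: D_poly_def R_rel_def pderiv_pCons map_poly_pCons)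
  then show ?thesis
    by (simp add: of_laurent_simps(3) of_laurent_single of_laurent_numeral)
qed

lemma D_t: "D t = u"
  by transfer (simp add: D_poly_def R_rel_def pderiv_pCons map_poly_pCons laurent_deriv_single)

lemma derivation_t_pow:
  assumes "derivation \<delta>"
  shows "\<delta> (t_pow n) = scale_R (of_int n) (t_pow (n - 1)) * \<delta> t"
proof -
  have mult: "\<delta> (x * y) = x * \<delta> y + y * \<delta> x" for x y
    using assms unfolding derivation_iff by blast
  have shift: "t_pow (n - 1) * t = t_pow n" for n
    using t_pow_add[of "n - 1" 1] by simp
  have inv: "t_pow (-1) * t = 1"
    using t_pow_add[of "-1" 1] by (simp add: t_pow_0)
  have step: "\<delta> (t_pow n) = t_pow (n - 1) * \<delta> t + t * \<delta> (t_pow (n - 1))" for n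
    using mult[of "t_pow (n - 1)" t] shift[of n] by simp
  show ?thesis
  proof (induction n rule: int_induct[where k = 0])
    case base
    have "\<delta> 1 = 0" using mult[of 1 1] by simp
    then show ?case by (simp add: t_pow_0)
  next
    case (step1 i)
    have "t * scale_R (of_int i) (t_pow (i - 1)) = scale_R (of_int i) (t_pow i)"
      by (metis scale_R_mult_right mult.commute shift)
    then show ?case
      using step[of "i + 1"] step1
      by (simp add: R.scale_left_distrib distrib_right mult.assoc[symmetric])
  next
    case (step2 i)
    have "t * \<delta> (t_pow (i - 1)) = scale_R (of_int i) (t_pow (i - 1)) * \<delta> t - t_pow (i - 1) * \<delta> t"
      using step[of i] step2 by (simp add: algebra_simps)
    also have "\<dots> = scale_R (of_int (i - 1)) (t_pow (i - 1)) * \<delta> t"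
      by (simp add: R.scale_left_diff_distrib algebra_simps)
    finally have "t_pow (-1) * (t * \<delta> (t_pow (i - 1)))
        = t_pow (-1) * (scale_R (of_int (i - 1)) (t_pow (i - 1)) * \<delta> t)"
      by simp
    moreover have "t_pow (-1) * scale_R (of_int (i - 1)) (t_pow (i - 1))
        = scale_R (of_int (i - 1)) (t_pow (i - 1 - 1))"
      using t_pow_add[of "-1" "i - 1"] by (simp add: scale_R_mult_right)
    ultimately show ?case
      using inv by (simp add: mult.assoc[symmetric])
  qed
qed

lemma derivation_of_laurent:
  assumes "derivation \<delta>"
  shows "\<delta> (of_laurent p) = of_laurent (laurent_deriv p) * \<delta> t"
proof (induction p rule: poly_mapping_add_induct)
  case zero
  then show ?case using derivation_diff[OF assms, of 0 0] by (simp add: of_laurent_simps)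
next
  case (single k c)
  have "\<delta> (scale_R c (t_pow k)) = scale_R c (\<delta> (t_pow k))"
    using assms by (simp add: derivation_iff)
  then show ?case
    by (simp add: of_laurent_single laurent_deriv_single derivation_t_pow[OF assms, of k]
        scale_R_mult_left)
next
  case (add f g)
  have "\<delta> (of_laurent f + of_laurent g) = \<delta> (of_laurent f) + \<delta> (of_laurent g)"
    using assms by (simp add: derivation_iff)
  then show ?case using add
    by (simp add: laurent_deriv_add of_laurent_simps algebra_simps)
qed

lemma derivation_eqI:
  assumes "derivation \<delta>" "derivation \<epsilon>" "\<delta> t = \<epsilon> t" "\<delta> u = \<epsilon> u"
  shows "\<delta> = \<epsilon>"
proof
  fix r
  obtain p q where r: "r = of_laurent p + of_laurent q * u" using R_normal_form by blast
  have "\<delta>' r = of_laurent (laurent_deriv p) * \<delta>' t + of_laurent q * \<delta>' u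
      + u * (of_laurent (laurent_deriv q) * \<delta>' t)" if "derivation \<delta>'" for \<delta>'
    using that derivation_of_laurent[OF that] by (simp add: r derivation_iff)
  from this[OF assms(1)] this[OF assms(2)] show "\<delta> r = \<epsilon> r" using assms(3,4) by simp
qed

lemma derivation_eq_mult_D:
  assumes "derivation \<delta>"
  shows "\<exists>f. \<delta> = (\<lambda>x. f * D x)"
proof -
  define T where "T = lmonom 1 1"
  obtain a b where ab: "\<delta> t = of_laurent a + of_laurent b * u" using R_normal_form by blast
  obtain c e where ce: "\<delta> u = of_laurent c + of_laurent e * u" using R_normal_form by blast
  have T4: "u_square = T * (T + 4)"
    using mult_single[of "1::int" "1::complex" 0 4]
    by (simp add: u_square_def T_def distrib_left mult_single)
  have deriv_w: "laurent_deriv u_square = 2 * (T + 2)"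
  proof -
    have "2 * lmonom 1 1 = lmonom 1 2" by (metis mult_2 single_add one_add_one)
    then show ?thesis
      by (simp add: u_square_def T_def laurent_deriv_add laurent_deriv_single distrib_left)
  qed
  have "u * \<delta> u + u * \<delta> u = \<delta> (u * u)" using assms by (simp add: derivation_iff)
  also have "\<dots> = of_laurent (2 * (T + 2)) * \<delta> t"
    by (simp add: u_mult_u derivation_of_laurent[OF assms] deriv_w)
  finally have "of_laurent (2 * (e * u_square)) + of_laurent (2 * c) * u
      = of_laurent (2 * ((T + 2) * a)) + of_laurent (2 * ((T + 2) * b)) * u"
    by (simp add: ab ce of_laurent_simps of_laurent_numeral algebra_simps flip: u_mult_u)
  then have "2 * (e * u_square) = 2 * ((T + 2) * a) \<and> 2 * c = 2 * ((T + 2) * b)"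
    by (rule R_normal_form_unique)
  then have e: "e * u_square = (T + 2) * a" and c: "c = (T + 2) * b"
    by (auto simp only: mult_cancel_left) auto
  define g where "g = lmonom (-1) 1 * lmonom 0 (1/2) * (a - T * e)"
  have half: "2 * lmonom 0 (1/2) = 1"
    using mult_single[of "0::int" "2::complex" 0 "1/2"] by simp
  have inv: "T * lmonom (-1) 1 = 1"
    by (simp add: T_def mult_single)
  have "2 * (u_square * g) = (T * lmonom (-1) 1) * (2 * lmonom 0 (1/2)) * ((T + 4) * (a - T * e))"
    by (simp add: T4 g_def ac_simps)
  also have "\<dots> = (T + 4) * a - e * u_square"
    unfolding half inv by (simp add: T4 algebra_simps)
  also have "\<dots> = 2 * a" unfolding e by (simp add: algebra_simps)
  finally have a: "u_square * g = a" by (simp only: mult_cancel_left) simp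
  have "u_square * e = u_square * ((T + 2) * g)"
    using e a by (simp add: ac_simps)
  then have e': "e = (T + 2) * g" using u_square_nonzero by (simp only: mult_cancel_left) simp
  define f where "f = of_laurent b + of_laurent g * u"
  have Du: "D u = of_laurent (T + 2)"
    by (simp add: D_u T_def of_laurent_simps of_laurent_numeral of_laurent_single)
  have "\<delta> = (\<lambda>x. f * D x)"
  proof (rule derivation_eqI[OF assms derivation_mult_D])
    show "\<delta> t = f * D t"
      by (simp add: ab f_def D_t of_laurent_simps algebra_simps flip: a u_mult_u)
    show "\<delta> u = f * D u"
      by (simp add: ce c e' f_def Du of_laurent_simps algebra_simps)
  qed
  then show ?thesis by blast
qed

lemma mult_D_add: "mult_D (f + g) = mult_D f + mult_D g"
  by transfer (simp add: fun_eq_iff algebra_simps)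

lemma mult_D_scale: "mult_D (scale_R c f) = scale_Der c (mult_D f)"
  by transfer (simp add: fun_eq_iff scale_R_mult_left)

lemma mult_D_0 [simp]: "mult_D 0 = 0"
  by transfer simp

lemma mult_D_surj: "\<exists>f. x = mult_D f"
  by transfer (use derivation_eq_mult_D in blast)

lemma mult_D_eq_0D: "mult_D f = 0 \<Longrightarrow> f = 0"
proof -
  assume "mult_D f = 0"
  then have "f * u = 0" by (metis D_t mult_D.rep_eq zero_Der.rep_eq)
  moreover obtain p q where f: "f = of_laurent p + of_laurent q * u" using R_normal_form by blast
  ultimately have "of_laurent (q * u_square) + of_laurent p * u = 0"
    by (simp add: of_laurent_simps algebra_simps flip: u_mult_u)
  then have "q * u_square = 0 \<and> p = 0" by (rule R_normal_form_zero)
  then show "f = 0" using u_square_nonzero by (simp add: f of_laurent_simps)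
qed

definition laurent_D :: "laurent \<Rightarrow> laurent \<Rightarrow> Der" where
  "laurent_D p q = mult_D (of_laurent p + of_laurent q * u)"

lemma laurent_D_add: "laurent_D (p + p') (q + q') = laurent_D p q + laurent_D p' q'"
  by (simp add: laurent_D_def of_laurent_simps mult_D_add algebra_simps)

lemma laurent_D_scale:
  "laurent_D (lmonom 0 c * p) (lmonom 0 c * q) = scale_Der c (laurent_D p q)"
  by (simp add: laurent_D_def of_laurent_scale scale_R_mult_left R.scale_right_distrib
      flip: mult_D_scale)

lemma laurent_D_eq_0D: "laurent_D p q = 0 \<Longrightarrow> p = 0 \<and> q = 0"
  unfolding laurent_D_def by (intro R_normal_form_zero mult_D_eq_0D)

lemma laurent_D_d1: "scale_Der c (d1 n) = laurent_D (lmonom n c) 0"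
  by (simp add: laurent_D_def d1_def of_laurent_simps of_laurent_single flip: mult_D_scale)

lemma laurent_D_d: "scale_Der c (d n) = laurent_D 0 (lmonom n c)"
  by (simp add: laurent_D_def d_def of_laurent_simps of_laurent_single scale_R_mult_left
      flip: mult_D_scale)

lemma inj_d1: "inj d1"
proof (rule injI)
  fix m n assume "d1 m = d1 n"
  then have "laurent_D (lmonom m 1) 0 + laurent_D (lmonom n (-1)) 0 = 0"
    by (simp flip: laurent_D_d1)
  then have "lmonom m 1 + lmonom n (-1) = 0"
    using laurent_D_add laurent_D_eq_0D by (metis add_0_right)
  then have "Poly_Mapping.lookup (lmonom m 1 + lmonom n (-1)) m = 0" by simp
  then show "m = n" by (auto simp: lookup_add lookup_single when_def split: if_splits)
qed

lemma inj_d: "inj d"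
proof (rule injI)
  fix m n assume "d m = d n"
  then have "laurent_D 0 (lmonom m 1) + laurent_D 0 (lmonom n (-1)) = 0"
    by (simp flip: laurent_D_d)
  then have "lmonom m 1 + lmonom n (-1) = 0"
    using laurent_D_add laurent_D_eq_0D by (metis add_0_right)
  then have "Poly_Mapping.lookup (lmonom m 1 + lmonom n (-1)) m = 0" by simp
  then show "m = n" by (auto simp: lookup_add lookup_single when_def split: if_splits)
qed

lemma d1_neq_d: "d1 m \<noteq> d n"
proof
  assume "d1 m = d n"
  then have "laurent_D (lmonom m 1) 0 + laurent_D 0 (lmonom n (-1)) = 0"
    by (simp flip: laurent_D_d laurent_D_d1)
  then have "lmonom m 1 = 0"
    using laurent_D_add laurent_D_eq_0D by (metis add_0_right)
  then have "Poly_Mapping.lookup (lmonom m 1) m = 0" by simp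
  then show False by simp
qed

lemma laurent_D_sum:
  "finite A \<Longrightarrow> laurent_D (\<Sum>i\<in>A. p i) (\<Sum>i\<in>A. q i) = (\<Sum>i\<in>A. laurent_D (p i) (q i))"
  by (induction A rule: finite_induct)
    (simp_all add: laurent_D_add, simp add: laurent_D_def of_laurent_simps)

theorem Der_span: "Der.span (range d1 \<union> range d) = UNIV"
proof -
  let ?S = "Der.span (range d1 \<union> range d)"
  have p: "laurent_D p 0 \<in> ?S" for p
  proof (induction p rule: poly_mapping_add_induct)
    case zero then show ?case by (simp add: laurent_D_def of_laurent_simps Der.span_zero)
  next
    case (single k c) then show ?case
      by (simp add: Der.span_scale Der.span_base flip: laurent_D_d1)
  next
    case (add f g) then show ?case
      using laurent_D_add[of f g 0 0] by (simp add: Der.span_add)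
  qed
  have q: "laurent_D 0 p \<in> ?S" for p
  proof (induction p rule: poly_mapping_add_induct)
    case zero then show ?case by (simp add: laurent_D_def of_laurent_simps Der.span_zero)
  next
    case (single k c) then show ?case
      by (simp add: Der.span_scale Der.span_base flip: laurent_D_d)
  next
    case (add f g) then show ?case
      using laurent_D_add[of 0 0 f g] by (simp add: Der.span_add)
  qed
  have "x \<in> ?S" for x
  proof -
    obtain f where "x = mult_D f" using mult_D_surj by blast
    moreover obtain p q where "f = of_laurent p + of_laurent q * u" using R_normal_form by blast
    ultimately have "x = laurent_D p q" by (simp add: laurent_D_def)
    also have "\<dots> = laurent_D p 0 + laurent_D 0 q" by (simp flip: laurent_D_add)
    finally show ?thesis using p q by (simp add: Der.span_add)
  qed
  then show ?thesis by auto
qed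

theorem Der_independent: "Der.independent (range d1 \<union> range d)"
proof -
  have "c v = 0" if S: "finite S" "S \<subseteq> range d1 \<union> range d"
    and sum: "(\<Sum>v\<in>S. scale_Der (c v) v) = 0" and v: "v \<in> S" for S c v
  proof -
    define A where "A = {n. d1 n \<in> S}"
    define B where "B = {n. d n \<in> S}"
    have fin: "finite A" "finite B"
      unfolding A_def B_def using S(1) inj_d1 inj_d by (auto intro!: finite_vimageI[unfolded vimage_def])
    have S': "S = d1 ` A \<union> d ` B" using S(2) by (auto simp: A_def B_def)
    have "(\<Sum>v\<in>S. scale_Der (c v) v)
        = (\<Sum>v\<in>d1 ` A. scale_Der (c v) v) + (\<Sum>v\<in>d ` B. scale_Der (c v) v)"
      unfolding S' using fin d1_neq_d by (intro sum.union_disjoint) auto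
    also have "(\<Sum>v\<in>d1 ` A. scale_Der (c v) v) = (\<Sum>n\<in>A. laurent_D (lmonom n (c (d1 n))) 0)"
      by (subst sum.reindex) (use inj_d1 in \<open>auto simp: inj_on_def inj_def laurent_D_d1\<close>)
    also have "\<dots> = laurent_D (\<Sum>n\<in>A. lmonom n (c (d1 n))) 0"
      using laurent_D_sum[OF fin(1), of "\<lambda>n. lmonom n (c (d1 n))" "\<lambda>_. 0"] by simp
    also have "(\<Sum>v\<in>d ` B. scale_Der (c v) v) = (\<Sum>n\<in>B. laurent_D 0 (lmonom n (c (d n))))"
      by (subst sum.reindex) (use inj_d in \<open>auto simp: inj_on_def inj_def laurent_D_d\<close>)
    also have "\<dots> = laurent_D 0 (\<Sum>n\<in>B. lmonom n (c (d n)))"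
      using laurent_D_sum[OF fin(2), of "\<lambda>_. 0" "\<lambda>n. lmonom n (c (d n))"] by simp
    finally have "laurent_D (\<Sum>n\<in>A. lmonom n (c (d1 n))) (\<Sum>n\<in>B. lmonom n (c (d n))) = 0"
      using sum by (simp flip: laurent_D_add)
    then have *: "(\<Sum>n\<in>A. lmonom n (c (d1 n))) = 0" "(\<Sum>n\<in>B. lmonom n (c (d n))) = 0"
      using laurent_D_eq_0D by blast+
    have "c (d1 n) = 0" if "n \<in> A" for n
      using arg_cong[OF *(1), of "\<lambda>p. Poly_Mapping.lookup p n"] that fin
      by (simp add: lookup_sum lookup_single when_def sum.delta)
    moreover have "c (d n) = 0" if "n \<in> B" for n
      using arg_cong[OF *(2), of "\<lambda>p. Poly_Mapping.lookup p n"] that fin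
      by (simp add: lookup_sum lookup_single when_def sum.delta)
    ultimately show "c v = 0" using v by (auto simp: S')
  qed
  then show ?thesis unfolding Der.independent_explicit_module by blast
qed

lemma (in lie_algebra) bilinear_form_ex1:
  assumes B: "independent B" "span B = UNIV"
  shows "\<exists>!\<phi>. bilinear_form \<phi> \<and> (\<forall>a\<in>B. \<forall>b\<in>B. \<phi> a b = h a b)"
proof (rule ex_ex1I)
  let ?r = "representation B"
  have vsk: "vector_space ((*) :: 'k \<Rightarrow> 'k \<Rightarrow> 'k)"
    by unfold_locales (simp_all add: algebra_simps)
  interpret pair: vector_space_pair scale "(*) :: 'k \<Rightarrow> 'k \<Rightarrow> 'k"
    by (intro vector_space_pair.intro vector_space_axioms vsk)
  define \<psi> where "\<psi> g x = (\<Sum>a | ?r x a \<noteq> 0. ?r x a * g a)" for g :: "'g \<Rightarrow> 'k" and x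
  have \<psi>: "\<psi> g x = (\<Sum>a\<in>A. ?r x a * g a)" if "finite A" "{a. ?r x a \<noteq> 0} \<subseteq> A" for A g x
    unfolding \<psi>_def using that by (intro sum.mono_neutral_left) auto
  have linr: "?r (x + y) a = ?r x a + ?r y a" "?r (scale c x) a = c * ?r x a" for x y a c
    using B by (simp_all add: representation_add representation_scale)
  have lin: "Vector_Spaces.linear scale (*) (\<psi> g)" for g
  proof (unfold Vector_Spaces.linear_iff,
      intro conjI allI vector_space_axioms vsk)
    fix x y
    let ?A = "{a. ?r x a \<noteq> 0} \<union> {a. ?r y a \<noteq> 0}"
    have fin: "finite ?A" by (simp add: finite_representation)
    have "{a. ?r (x + y) a \<noteq> 0} \<subseteq> ?A" by (auto simp: linr)
    then have "\<psi> g (x + y) = (\<Sum>a\<in>?A. ?r (x + y) a * g a)" by (rule \<psi>[OF fin])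
    also have "\<dots> = (\<Sum>a\<in>?A. ?r x a * g a) + (\<Sum>a\<in>?A. ?r y a * g a)"
      by (simp only: linr distrib_right sum.distrib)
    also have "(\<Sum>a\<in>?A. ?r x a * g a) = \<psi> g x" by (rule \<psi>[OF fin, symmetric]) simp
    also have "(\<Sum>a\<in>?A. ?r y a * g a) = \<psi> g y" by (rule \<psi>[OF fin, symmetric]) simp
    finally show "\<psi> g (x + y) = \<psi> g x + \<psi> g y" .
  next
    fix c x
    have "{a. ?r (scale c x) a \<noteq> 0} \<subseteq> {a. ?r x a \<noteq> 0}" by (auto simp: linr)
    then have "\<psi> g (scale c x) = (\<Sum>a | ?r x a \<noteq> 0. ?r (scale c x) a * g a)"
      by (intro \<psi> finite_representation)
    also have "\<dots> = c * \<psi> g x"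
      by (simp only: linr \<psi>_def sum_distrib_left mult.assoc)
    finally show "\<psi> g (scale c x) = c * \<psi> g x" .
  qed
  have lin_add: "\<psi> g (x + y) = \<psi> g x + \<psi> g y"
    and lin_scale: "\<psi> g (scale c x) = c * \<psi> g x"
    for g x y c
    using lin unfolding Vector_Spaces.linear_iff by blast+
  have basis: "\<psi> g b = g b" if "b \<in> B" for g b
  proof -
    have "\<psi> g b = (\<Sum>a\<in>{b}. ?r b a * g a)"
      using that B by (intro \<psi>) (auto simp: representation_basis split: if_splits)
    then show ?thesis using that B by (simp add: representation_basis)
  qed
  have lin': "Vector_Spaces.linear scale (*) (\<lambda>y. \<psi> (\<lambda>a. \<psi> (h a) y) x)" for x
    unfolding \<psi>_def[of _ x]
  proof (unfold Vector_Spaces.linear_iff,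
      intro conjI allI vector_space_axioms vsk)
    fix y z
    show "(\<Sum>a | ?r x a \<noteq> 0. ?r x a * \<psi> (h a) (y + z))
        = (\<Sum>a | ?r x a \<noteq> 0. ?r x a * \<psi> (h a) y) + (\<Sum>a | ?r x a \<noteq> 0. ?r x a * \<psi> (h a) z)"
      by (simp only: lin_add distrib_left sum.distrib)
  next
    fix c y
    show "(\<Sum>a | ?r x a \<noteq> 0. ?r x a * \<psi> (h a) (scale c y))
        = c * (\<Sum>a | ?r x a \<noteq> 0. ?r x a * \<psi> (h a) y)"
      by (simp only: lin_scale sum_distrib_left mult.left_commute)
  qed
  from lin' have "bilinear_form (\<lambda>x y. \<psi> (\<lambda>a. \<psi> (h a) y) x)"
    using lin by (simp add: bilinear_form_def)
  moreover have "\<forall>a\<in>B. \<forall>b\<in>B. \<psi> (\<lambda>a. \<psi> (h a) b) a = h a b" by (simp add: basis)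
  ultimately show "\<exists>\<phi>. bilinear_form \<phi> \<and> (\<forall>a\<in>B. \<forall>b\<in>B. \<phi> a b = h a b)"
    by (intro exI[of _ "\<lambda>x y. \<psi> (\<lambda>a. \<psi> (h a) y) x"]) simp
  fix \<phi> \<theta>
  assume \<phi>: "bilinear_form \<phi> \<and> (\<forall>a\<in>B. \<forall>b\<in>B. \<phi> a b = h a b)"
    and \<theta>: "bilinear_form \<theta> \<and> (\<forall>a\<in>B. \<forall>b\<in>B. \<theta> a b = h a b)"
  have 1: "\<phi> a y = \<theta> a y" if "a \<in> B" for a y
    using pair.linear_eq_on[of "\<phi> a" "\<theta> a" y B] that \<phi> \<theta> B by (auto simp: bilinear_form_def)
  have "\<phi> x y = \<theta> x y" for x y
    using pair.linear_eq_on[of "\<lambda>x. \<phi> x y" "\<lambda>x. \<theta> x y" x B] 1 \<phi> \<theta> B by (auto simp: bilinear_form_def)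
  then show "\<phi> = \<theta>" by blast
qed


section \<open>The forms \<open>\<phi>\<^sub>1\<close> and \<open>\<phi>\<^sub>2\<close>\<close>

text \<open>\<open>has_values \<phi> a b b' c\<close>: \<open>\<phi>\<close> is bilinear with
  \<open>\<phi>(d\<^sup>1\<^sub>k, d\<^sup>1\<^sub>l) = a k l\<close>, \<open>\<phi>(d\<^sup>1\<^sub>k, d\<^sub>l) = b k l\<close>, \<open>\<phi>(d\<^sub>k, d\<^sup>1\<^sub>l) = b' k l\<close> and \<open>\<phi>(d\<^sub>k, d\<^sub>l) = c k l\<close>.\<close>

definition has_values :: "(Der \<Rightarrow> Der \<Rightarrow> complex) \<Rightarrow> (int \<Rightarrow> int \<Rightarrow> complex) \<Rightarrow>
    (int \<Rightarrow> int \<Rightarrow> complex) \<Rightarrow> (int \<Rightarrow> int \<Rightarrow> complex) \<Rightarrow> (int \<Rightarrow> int \<Rightarrow> complex) \<Rightarrow> bool" where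
  "has_values \<phi> a b b' c \<longleftrightarrow> Der.bilinear_form \<phi> \<and>
     (\<forall>k l. \<phi> (d1 k) (d1 l) = a k l \<and> \<phi> (d1 k) (d l) = b k l \<and>
            \<phi> (d k) (d1 l) = b' k l \<and> \<phi> (d k) (d l) = c k l)"

lemma has_values_ex1: "\<exists>!\<phi>. has_values \<phi> a b b' c"
proof -
  define h where "h x y =
    (if x \<in> range d1
     then (if y \<in> range d1 then a (inv d1 x) (inv d1 y) else b (inv d1 x) (inv d y))
     else (if y \<in> range d1 then b' (inv d x) (inv d1 y) else c (inv d x) (inv d y)))" for x y
  have "has_values \<phi> a b b' c \<longleftrightarrow> Der.bilinear_form \<phi> \<and>
      (\<forall>x \<in> range d1 \<union> range d. \<forall>y \<in> range d1 \<union> range d. \<phi> x y = h x y)" for \<phi>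
  proof -
    have "d n \<notin> range d1" for n using d1_neq_d by (metis imageE)
    then have "h (d1 k) (d1 l) = a k l" "h (d1 k) (d l) = b k l"
      "h (d k) (d1 l) = b' k l" "h (d k) (d l) = c k l" for k l
      by (simp_all add: h_def inv_f_f[OF inj_d1] inv_f_f[OF inj_d])
    then show ?thesis unfolding has_values_def by (simp add: ball_Un) blast
  qed
  then show ?thesis
    using Der.bilinear_form_ex1[OF Der_independent Der_span, of h] by simp
qed

text \<open>The form defined bilinearly by its values on the basis; it exists and is unique by the
  previous lemma.\<close>

definition form_of :: "(int \<Rightarrow> int \<Rightarrow> complex) \<Rightarrow> (int \<Rightarrow> int \<Rightarrow> complex) \<Rightarrow>
    (int \<Rightarrow> int \<Rightarrow> complex) \<Rightarrow> (int \<Rightarrow> int \<Rightarrow> complex) \<Rightarrow> Der \<Rightarrow> Der \<Rightarrow> complex" where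
  "form_of a b b' c = (THE \<phi>. has_values \<phi> a b b' c)"

lemma has_values_form_of: "has_values (form_of a b b' c) a b b' c"
  unfolding form_of_def by (rule theI'[OF has_values_ex1])

lemma form_of_bilinear: "Der.bilinear_form (form_of a b b' c)"
  and form_of_values:
    "form_of a b b' c (d1 k) (d1 l) = a k l" "form_of a b b' c (d1 k) (d l) = b k l"
    "form_of a b b' c (d k) (d1 l) = b' k l" "form_of a b b' c (d k) (d l) = c k l"
  using has_values_form_of[of a b b' c] by (simp_all add: has_values_def)

text \<open>Double factorial extended to negative odd integers by \<open>n!! = n (n - 2)!!\<close>; only the values at
  odd arguments are used.\<close>

function double_fact :: "int \<Rightarrow> complex" where
  "double_fact n =
     (if n > 0 then of_int n * double_fact (n - 2)
      else if n < -1 then double_fact (n + 2) / of_int (n + 2)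
      else 1)"
  by auto
termination
  by (relation "measure (\<lambda>n. nat \<bar>2 * n + 1\<bar>)") auto

declare double_fact.simps [simp del]

lemma double_fact_rec:
  assumes "odd n" shows "double_fact n = of_int n * double_fact (n - 2)"
proof -
  have "n \<noteq> 0" using assms by auto
  then consider "n > 0" | "n \<le> -1" by linarith
  then show ?thesis
  proof cases
    case 1 then show ?thesis by (simp add: double_fact.simps[of n])
  next
    case 2 then show ?thesis by (simp add: double_fact.simps[of "n - 2"])
  qed
qed

lemma double_fact_minus_1: "double_fact (-1) = 1"
  by (simp add: double_fact.simps)

text \<open>\<open>1/n!\<close>, with the convention that it vanishes for negative \<open>n\<close>.\<close>

definition inverse_fact :: "int \<Rightarrow> complex" where
  "inverse_fact n = (if n < 0 then 0 else 1 / fact (nat n))"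

definition kronecker :: "int \<Rightarrow> int \<Rightarrow> complex" where
  "kronecker m n = (if m = n then 1 else 0)"

text \<open>The common value of \<open>\<phi>\<^sub>1(d\<^sup>1\<^sub>k, d\<^sub>l)\<close> and \<open>- \<phi>\<^sub>1(d\<^sub>l, d\<^sup>1\<^sub>k)\<close>.\<close>

definition phi1_d1_d :: "int \<Rightarrow> int \<Rightarrow> complex" where
  "phi1_d1_d k l = 6 * (-1) powi (k + l) * 2 powi (k + l) * of_int ((k - 1) * k * l) *
     double_fact (2 * k + 2 * l - 3) * inverse_fact (k + l + 1)"

definition phi1 :: "Der \<Rightarrow> Der \<Rightarrow> complex" where
  "phi1 = form_of
     (\<lambda>k l. of_int (2 * (l^2 - l) * (2 * l - 1)) * kronecker (k + l) 1
          + of_int (l^3 - l) * kronecker (k + l) 0)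
     (\<lambda>k l. phi1_d1_d k l)
     (\<lambda>l k. - phi1_d1_d k l)
     (\<lambda>k l. of_int (l * (l + 1) * (l + 2)) * kronecker (k + l) (-2)
          + of_int (4 * l * (2 * l + 1) * (l + 1)) * kronecker (k + l) (-1)
          + of_int (4 * l * (2 * l - 1) * (2 * l + 1)) * kronecker (k + l) 0)"

definition phi2 :: "Der \<Rightarrow> Der \<Rightarrow> complex" where
  "phi2 = form_of
     (\<lambda>k l. -2 * phi1 (d1 k) (d1 l))
     (\<lambda>k l. 0)
     (\<lambda>k l. 0)
     (\<lambda>k l. -2 * phi1 (d k) (d l))"

lemma phi1_bilinear: "Der.bilinear_form phi1"
  and phi1_values:
    "phi1 (d1 k) (d1 l) = of_int (2 * (l^2 - l) * (2 * l - 1)) * kronecker (k + l) 1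
       + of_int (l^3 - l) * kronecker (k + l) 0"
    "phi1 (d1 k) (d l) = phi1_d1_d k l"
    "phi1 (d l) (d1 k) = - phi1 (d1 k) (d l)"
    "phi1 (d k) (d l) = of_int (l * (l + 1) * (l + 2)) * kronecker (k + l) (-2)
       + of_int (4 * l * (2 * l + 1) * (l + 1)) * kronecker (k + l) (-1)
       + of_int (4 * l * (2 * l - 1) * (2 * l + 1)) * kronecker (k + l) 0"
  by (simp_all only: phi1_def form_of_bilinear form_of_values)

lemma phi2_bilinear: "Der.bilinear_form phi2"
  and phi2_values:
    "phi2 (d1 k) (d1 l) = -2 * phi1 (d1 k) (d1 l)"
    "phi2 (d k) (d l) = -2 * phi1 (d k) (d l)"
    "phi2 (d1 k) (d l) = 0"
    "phi2 (d l) (d1 k) = 0"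
  by (simp_all only: phi2_def form_of_bilinear form_of_values)

end

theory Submission
  imports Defs
begin

text \<open>All conditions are multilinear and are checked on the basis. The even part of
  \<open>\<phi>\<^sub>1\<close> is polynomial and supported on finitely many values of \<open>k + l + m\<close>, so there
  the cocycle condition is a polynomial identity on each such plane. The odd part equals
  \<open>6 (k - 1) k l \<psi>(k + l)\<close> with \<open>\<psi>(n) = (-2)\<^sup>n (2n - 3)!! / (n + 1)!\<close>, and the recurrence
  \<open>(n + 2) \<psi>(n + 1) = -2 (2n - 1) \<psi>(n)\<close>, valid for every integer \<open>n\<close>, reduces the condition to a
  polynomial identity as well. On \<open>d\<^sup>1\<^sub>k, d\<^sup>1\<^sub>1\<^sub>-\<^sub>k\<close> a coboundary \<open>f([a,b])\<close> is a linear function of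
  \<open>k\<close>, whereas \<open>\<phi>\<^sub>i\<close> is cubic; so neither cocycle is a coboundary.\<close>

section \<open>Cocycles on a spanning set\<close>

lemma (in lie_algebra) subspace_linear_kernel:
  assumes "Vector_Spaces.linear scale (*) f"
  shows "subspace {x. f x = 0}"
  using assms by (auto simp: subspace_def Vector_Spaces.linear_iff dest: spec[of _ 0])

lemma (in lie_algebra) linear_eq_0_on_span:
  assumes "Vector_Spaces.linear scale (*) f" "span B = UNIV" "\<And>b. b \<in> B \<Longrightarrow> f b = 0"
  shows "f x = 0"
  using span_minimal[OF _ subspace_linear_kernel[OF assms(1)], of B] assms(2,3) by auto

text \<open>The defects \<open>S\<close> of skew symmetry and \<open>J\<close> of the cyclic
  identity are linear in each argument, so vanishing on \<open>B\<close> extends to the whole space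
  by releasing one argument at a time.\<close>

lemma (in lie_algebra) two_cocycle_basisI:
  fixes \<phi> :: "'g \<Rightarrow> 'g \<Rightarrow> 'k"
  assumes bil: "bilinear_form \<phi>" and B: "span B = UNIV"
    and skew: "\<And>a b. a \<in> B \<Longrightarrow> b \<in> B \<Longrightarrow> \<phi> a b = - \<phi> b a"
    and cyc: "\<And>a b c. a \<in> B \<Longrightarrow> b \<in> B \<Longrightarrow> c \<in> B \<Longrightarrow>
      \<phi> (bracket a b) c + \<phi> (bracket b c) a + \<phi> (bracket c a) b = 0"
  shows "two_cocycle \<phi>"
proof -
  note eq_0 = linear_eq_0_on_span[OF _ B]
  have lin: "\<phi> (x + y) z = \<phi> x z + \<phi> y z" "\<phi> (scale r x) z = r * \<phi> x z"
    "\<phi> z (x + y) = \<phi> z x + \<phi> z y" "\<phi> z (scale r x) = r * \<phi> z x" for x y z r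
    using bil by (simp_all add: bilinear_form_def Vector_Spaces.linear_iff)
  have blin: "bracket (x + y) z = bracket x z + bracket y z"
    "bracket (scale r x) z = scale r (bracket x z)"
    "bracket z (x + y) = bracket z x + bracket z y"
    "bracket z (scale r x) = scale r (bracket z x)" for x y z r
    using bracket_linear_left bracket_linear_right by (simp_all add: Vector_Spaces.linear_iff)
  have vsk: "vector_space ((*) :: 'k \<Rightarrow> 'k \<Rightarrow> 'k)"
    by unfold_locales (simp_all add: algebra_simps)
  note linI = Vector_Spaces.linear_iff lin blin vsk vector_space_axioms distrib_left add_ac simp_thms
  define S where "S a b = \<phi> a b + \<phi> b a" for a b
  have S_lin: "Vector_Spaces.linear scale (*) (S a)" "Vector_Spaces.linear scale (*) (\<lambda>a. S a b)" for a b
    by (simp_all only: S_def linI)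
  have "S a b = 0" if "a \<in> B" "b \<in> B" for a b
    unfolding S_def by (subst skew[OF that]) simp
  then have "S a b = 0" if "b \<in> B" for a b
    using eq_0[OF S_lin(2)] that by blast
  then have S: "S a b = 0" for a b
    using eq_0[OF S_lin(1)] by blast
  define J where "J a b c = \<phi> (bracket a b) c + \<phi> (bracket b c) a + \<phi> (bracket c a) b" for a b c
  have J_lin: "Vector_Spaces.linear scale (*) (\<lambda>a. J a b c)"
    "Vector_Spaces.linear scale (*) (\<lambda>b. J a b c)"
    "Vector_Spaces.linear scale (*) (J a b)" for a b c
    by (simp_all only: J_def linI)
  have "J a b c = 0" if "b \<in> B" "c \<in> B" for a b c
    using eq_0[OF J_lin(1)] that cyc unfolding J_def by blast
  then have "J a b c = 0" if "c \<in> B" for a b c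
    using eq_0[OF J_lin(2)] that by blast
  then have "J a b c = 0" for a b c
    using eq_0[OF J_lin(3)] by blast
  then show ?thesis
    unfolding two_cocycle_def J_def using S bil by (simp only: S_def eq_neg_iff_add_eq_0) blast
qed

section \<open>Brackets of the basis elements\<close>

text \<open>The second-order terms \<open>f * g * D (D x)\<close> cancel because R is
  commutative.\<close>

lemma bracket_mult_D: "bracket_Der (mult_D f) (mult_D g) = mult_D (f * D g - g * D f)"
proof -
  have "D (x * y) = x * D y + y * D x" for x y
    using derivation_mult_D[of 1] by (simp add: derivation_iff)
  then show ?thesis
    by (transfer; simp add: fun_eq_iff algebra_simps)
qed

lemma D_t_pow: "D (t_pow n) = scale_R (of_int n) (t_pow (n - 1)) * u"
  using derivation_t_pow[OF derivation_mult_D[of 1], of n] by (simp add: D_t)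

lemma t_pow_u_u: "t_pow n * (u * u) = t_pow (n + 2) + scale_R 4 (t_pow (n + 1))"
  by (simp add: u_mult_u u_square_def of_laurent_simps of_laurent_single t_pow_add
      scale_R_mult_right distrib_left)

lemma D_t_pow_u:
  "D (t_pow n * u) = scale_R (of_int (n + 1)) (t_pow (n + 1)) + scale_R (of_int (4 * n + 2)) (t_pow n)"
proof -
  have two: "t_pow n * 2 = scale_R 2 (t_pow n)"
    using R.scale_left_distrib[of 1 1 "t_pow n"] by (simp add: mult_2_right)
  have "D (t_pow n * u) = t_pow n * D u + u * D (t_pow n)"
    using derivation_mult_D[of 1] by (simp add: derivation_iff)
  also have "u * D (t_pow n) = scale_R (of_int n) (t_pow (n - 1) * (u * u))"
    by (simp add: D_t_pow scale_R_mult_left scale_R_mult_right ac_simps)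
  also have "\<dots> = scale_R (of_int n) (t_pow (n + 1)) + scale_R (of_int n * 4) (t_pow n)"
    by (simp add: t_pow_u_u R.scale_right_distrib add.commute)
  also have "t_pow n * D u = t_pow (n + 1) + scale_R 2 (t_pow n)"
    by (simp add: D_u distrib_left two flip: t_pow_add)
  finally show ?thesis
    by (simp add: R.scale_left_distrib algebra_simps)
qed

text \<open>Since \<open>D\<close> exchanges the span of the t^n with that of the t^n u, the three
  bracket formulas form a grading modulo 2 with \<open>d\<close> even and \<open>d1\<close>
  odd.\<close>

lemma bracket_d1_d1: "bracket_Der (d1 k) (d1 l) = scale_Der (of_int (l - k)) (d (k + l - 1))"
proof -
  have "t_pow k * D (t_pow l) = scale_R (of_int l) (t_pow (k + l - 1) * u)" for k l
    using t_pow_add[of k "l - 1"]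
    by (simp add: D_t_pow scale_R_mult_left scale_R_mult_right algebra_simps)
  from this[of k l] this[of l k] show ?thesis
    by (simp add: d1_def d_def bracket_mult_D add.commute[of l k] R.scale_left_diff_distrib
        flip: mult_D_scale)
qed

lemma bracket_d1_d:
  "bracket_Der (d1 k) (d l) = scale_Der (of_int (l - k + 1)) (d1 (k + l + 1))
     + scale_Der (of_int (4 * l - 4 * k + 2)) (d1 (k + l))"
proof -
  have 1: "t_pow k * D (t_pow l * u) =
      scale_R (of_int (l + 1)) (t_pow (k + l + 1)) + scale_R (of_int (4 * l + 2)) (t_pow (k + l))"
    by (simp add: D_t_pow_u distrib_left scale_R_mult_right add.assoc flip: t_pow_add)
  have "t_pow l * u * D (t_pow k) = scale_R (of_int k) (t_pow (k + l - 1) * (u * u))"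
    using t_pow_add[of l "k - 1"]
    by (simp add: D_t_pow scale_R_mult_left scale_R_mult_right algebra_simps)
  also have "\<dots> = scale_R (of_int k) (t_pow (k + l + 1)) + scale_R (of_int (4 * k)) (t_pow (k + l))"
    by (simp add: t_pow_u_u R.scale_right_distrib mult.commute[of 4] add.commute add.left_commute)
  finally have 2: "t_pow l * u * D (t_pow k) = \<dots>" .
  have "t_pow k * D (t_pow l * u) - t_pow l * u * D (t_pow k) =
      scale_R (of_int (l - k + 1)) (t_pow (k + l + 1)) + scale_R (of_int (4 * l - 4 * k + 2)) (t_pow (k + l))"
    unfolding 1 2
    by (simp add: R.scale_left_diff_distrib R.scale_left_distrib algebra_simps)
  then show ?thesis
    by (simp only: d1_def d_def bracket_mult_D mult_D_add mult_D_scale)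
qed

lemma bracket_skew: "bracket_Der x y = - bracket_Der y x"
  by transfer (simp add: fun_eq_iff)

lemma bracket_d_d:
  "bracket_Der (d k) (d l) = scale_Der (of_int (l - k)) (d (k + l + 1))
     + scale_Der (of_int (4 * (l - k))) (d (k + l))"
proof -
  have 1: "t_pow k * u * D (t_pow l * u) =
      scale_R (of_int (l + 1)) (t_pow (k + l + 1) * u) + scale_R (of_int (4 * l + 2)) (t_pow (k + l) * u)"
    for k l
  proof -
    have "t_pow k * u * D (t_pow l * u) = u * (t_pow k * D (t_pow l * u))"
      by (simp add: ac_simps)
    also have "t_pow k * D (t_pow l * u)
        = scale_R (of_int (l + 1)) (t_pow (k + l + 1)) + scale_R (of_int (4 * l + 2)) (t_pow (k + l))"
      by (simp add: D_t_pow_u distrib_left scale_R_mult_right add.assoc flip: t_pow_add)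
    finally show ?thesis
      by (simp add: distrib_left scale_R_mult_right mult.commute[of u])
  qed
  have "t_pow k * u * D (t_pow l * u) - t_pow l * u * D (t_pow k * u) =
      scale_R (of_int (l - k)) (t_pow (k + l + 1) * u) + scale_R (of_int (4 * (l - k))) (t_pow (k + l) * u)"
    unfolding 1 add.commute[of l k]
    by (simp add: R.scale_left_diff_distrib R.scale_left_distrib algebra_simps)
  then show ?thesis
    by (simp only: d_def bracket_mult_D mult_D_add mult_D_scale)
qed

section \<open>The cocycle condition on the basis\<close>

text \<open>By the grading, the conditions on three \<open>d1\<close> or on one \<open>d1\<close>
  and two \<open>d\<close> involve only mixed values of \<phi>, and the other two conditions only
  unmixed ones. The even and odd parts of a form can therefore be checked separately.\<close>

lemma two_cocycle_d1_dI:
  assumes bil: "Der.bilinear_form \<phi>"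
    and skew: "\<And>k l. \<phi> (d1 k) (d1 l) = - \<phi> (d1 l) (d1 k)"
      "\<And>k l. \<phi> (d k) (d1 l) = - \<phi> (d1 l) (d k)" "\<And>k l. \<phi> (d k) (d l) = - \<phi> (d l) (d k)"
    and d1_d1_d1: "\<And>k l m. of_int (l - k) * \<phi> (d1 m) (d (k + l - 1))
      + of_int (m - l) * \<phi> (d1 k) (d (l + m - 1)) + of_int (k - m) * \<phi> (d1 l) (d (m + k - 1)) = 0"
    and d1_d1_d: "\<And>k l m. of_int (l - k) * \<phi> (d (k + l - 1)) (d m)
      + (of_int (m - l + 1) * \<phi> (d1 (l + m + 1)) (d1 k) + of_int (4 * m - 4 * l + 2) * \<phi> (d1 (l + m)) (d1 k))
      - (of_int (m - k + 1) * \<phi> (d1 (k + m + 1)) (d1 l) + of_int (4 * m - 4 * k + 2) * \<phi> (d1 (k + m)) (d1 l)) = 0"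
    and d1_d_d: "\<And>k l m.
      (of_int (l - k + 1) * \<phi> (d1 (k + l + 1)) (d m) + of_int (4 * l - 4 * k + 2) * \<phi> (d1 (k + l)) (d m))
      - (of_int (m - l) * \<phi> (d1 k) (d (l + m + 1)) + of_int (4 * (m - l)) * \<phi> (d1 k) (d (l + m)))
      - (of_int (m - k + 1) * \<phi> (d1 (k + m + 1)) (d l) + of_int (4 * m - 4 * k + 2) * \<phi> (d1 (k + m)) (d l)) = 0"
    and d_d_d: "\<And>k l m.
      (of_int (l - k) * \<phi> (d (k + l + 1)) (d m) + of_int (4 * (l - k)) * \<phi> (d (k + l)) (d m))
      + (of_int (m - l) * \<phi> (d (l + m + 1)) (d k) + of_int (4 * (m - l)) * \<phi> (d (l + m)) (d k))
      + (of_int (k - m) * \<phi> (d (m + k + 1)) (d l) + of_int (4 * (k - m)) * \<phi> (d (m + k)) (d l)) = 0"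
  shows "Der.two_cocycle \<phi>"
proof (rule Der.two_cocycle_basisI[OF bil Der_span])
  have "\<phi> (d1 k) (d l) = - \<phi> (d l) (d1 k)" for k l by (simp add: skew(2))
  then show "\<phi> a b = - \<phi> b a" if "a \<in> range d1 \<union> range d" "b \<in> range d1 \<union> range d" for a b
    using that skew by blast
next
  define J where "J a b c = \<phi> (bracket_Der a b) c + \<phi> (bracket_Der b c) a + \<phi> (bracket_Der c a) b"
    for a b c
  have J_cyc: "J a b c = J b c a" for a b c by (simp add: J_def)
  have lin: "\<phi> (x + y) z = \<phi> x z + \<phi> y z" "\<phi> (scale_Der r x) z = r * \<phi> x z" for x y z r
    using bil by (simp_all add: Der.bilinear_form_def Vector_Spaces.linear_iff)
  have neg: "\<phi> (- x) z = - \<phi> x z" for x z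
    using lin(1)[of x "- x" z] lin(1)[of 0 0 z] by (simp add: eq_neg_iff_add_eq_0 add.commute)
  have J111: "J (d1 k) (d1 l) (d1 m) = 0" for k l m
    using d1_d1_d1[of l k m] unfolding J_def bracket_d1_d1 lin skew(2)
    by (simp add: algebra_simps)
  have J110: "J (d1 k) (d1 l) (d m) = 0" for k l m
    using d1_d1_d[of l k m] unfolding J_def bracket_d1_d1 bracket_d1_d bracket_skew[of "d m"] lin neg
    by simp
  have J100: "J (d1 k) (d l) (d m) = 0" for k l m
    using d1_d_d[of l k m] unfolding J_def bracket_d_d bracket_d1_d bracket_skew[of "d m" "d1 k"] lin neg skew(2)
    by (simp add: algebra_simps)
  have J000: "J (d k) (d l) (d m) = 0" for k l m
    using d_d_d[of l k m] unfolding J_def bracket_d_d lin .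
  \<comment> \<open>Cyclic invariance of \<open>J\<close> supplies the remaining four of the eight
    patterns of \<open>d1\<close> and \<open>d\<close>.\<close>
  have J_rotated: "J (d1 k) (d m) (d1 l) = 0" "J (d m) (d1 k) (d1 l) = 0"
    "J (d m) (d1 k) (d l) = 0" "J (d l) (d m) (d1 k) = 0" for k l m
    using J110[of l k m] J_cyc[of "d1 l" "d1 k" "d m"] J110[of k l m] J_cyc[of "d m" "d1 k" "d1 l"]
      J100[of k l m] J_cyc[of "d m" "d1 k" "d l"] J_cyc[of "d1 k" "d l" "d m"]
    by simp_all
  fix a b c assume "a \<in> range d1 \<union> range d" "b \<in> range d1 \<union> range d" "c \<in> range d1 \<union> range d"
  then have "J a b c = 0"
    using J111 J110 J100 J000 J_rotated by auto
  then show "\<phi> (bracket_Der a b) c + \<phi> (bracket_Der b c) a + \<phi> (bracket_Der c a) b = 0"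
    by (simp add: J_def)
qed

section \<open>The even part of \<open>phi1\<close>\<close>

lemma phi1_d1_d1_d:
  "of_int (l - k) * phi1 (d (k + l - 1)) (d m)
      + (of_int (m - l + 1) * phi1 (d1 (l + m + 1)) (d1 k) + of_int (4 * m - 4 * l + 2) * phi1 (d1 (l + m)) (d1 k))
      - (of_int (m - k + 1) * phi1 (d1 (k + m + 1)) (d1 l) + of_int (4 * m - 4 * k + 2) * phi1 (d1 (k + m)) (d1 l)) = 0"
proof -
  \<comment> \<open>These are all values of k + l + m at which some Kronecker delta is nonzero;
    eliminating m leaves a polynomial identity in k and l.\<close>
  consider "m = -1 - k - l" | "m = - k - l" | "m = 1 - k - l" | "k + l + m \<notin> {-1, 0, 1}"
    by fastforce
  then show ?thesis
    unfolding phi1_values kronecker_def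
    by cases (hypsubst?, simp add: algebra_simps power2_eq_square power3_eq_cube)+
qed

lemma phi1_d_d_d:
  "(of_int (l - k) * phi1 (d (k + l + 1)) (d m) + of_int (4 * (l - k)) * phi1 (d (k + l)) (d m))
      + (of_int (m - l) * phi1 (d (l + m + 1)) (d k) + of_int (4 * (m - l)) * phi1 (d (l + m)) (d k))
      + (of_int (k - m) * phi1 (d (m + k + 1)) (d l) + of_int (4 * (k - m)) * phi1 (d (m + k)) (d l)) = 0"
proof -
  consider "m = -3 - k - l" | "m = -2 - k - l" | "m = -1 - k - l" | "m = - k - l"
    | "k + l + m \<notin> {-3, -2, -1, 0}"
    by fastforce
  then show ?thesis
    unfolding phi1_values kronecker_def
    by cases (hypsubst?, simp add: algebra_simps)+
qed

text \<open>On each line k + l = c of the support the coefficient is a cubic in l that changes sign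
  under l -> c - l.\<close>

lemma phi1_skew:
  "phi1 (d1 k) (d1 l) = - phi1 (d1 l) (d1 k)" "phi1 (d k) (d l) = - phi1 (d l) (d k)"
proof -
  consider "l = - k" | "l = 1 - k" | "k + l \<notin> {0, 1}"
    by fastforce
  then show "phi1 (d1 k) (d1 l) = - phi1 (d1 l) (d1 k)"
    unfolding phi1_values kronecker_def
    by cases (hypsubst?, simp add: algebra_simps power2_eq_square power3_eq_cube)+
  consider "l = - k" | "l = -1 - k" | "l = -2 - k" | "k + l \<notin> {-2, -1, 0}"
    by fastforce
  then show "phi1 (d k) (d l) = - phi1 (d l) (d k)"
    unfolding phi1_values kronecker_def
    by cases (hypsubst?, simp add: algebra_simps)+
qed

section \<open>The odd part of \<open>phi1\<close>\<close>

definition psi :: "int \<Rightarrow> complex" where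
  "psi n = (-2) powi n * double_fact (2 * n - 3) * inverse_fact (n + 1)"

lemma phi1_d1_d_psi: "phi1_d1_d k l = 6 * of_int ((k - 1) * k * l) * psi (k + l)"
proof -
  have "(-2 :: complex) powi n = (-1) powi n * 2 powi n" for n
    using power_int_mult_distrib[of "-1 :: complex" 2 n] by simp
  moreover have "2 * k + 2 * l - 3 = 2 * (k + l) - 3" by simp
  ultimately show ?thesis
    by (simp only: phi1_d1_d_def psi_def mult_ac)
qed

text \<open>At n = -1 the left factor is 0, which matches the convention for negative arguments, so
  the recurrence holds for every integer.\<close>

lemma inverse_fact_rec: "of_int (n + 1) * inverse_fact (n + 1) = inverse_fact n"
proof (cases "n \<ge> 0")
  case True
  then obtain j where n: "n = int j" using nonneg_int_cases by blast
  have "nat (int j + 1) = Suc j" "of_int (int j + 1) = (of_nat (Suc j) :: complex)" by simp_all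
  then show ?thesis
    unfolding n by (simp add: inverse_fact_def del: of_nat_Suc)
next
  case False
  then consider "n = -1" | "n < -1" by linarith
  then show ?thesis
    by cases (simp_all add: inverse_fact_def)
qed

text \<open>For n \<ge> -1, \<open>-6 * psi n\<close> is the coefficient of x^(n+1) in (1 +
  4x)^(3/2), and \<open>psi n\<close> is 0 below. Keeping the factor n + 2 on the left avoids a
  division by zero at n = -2.\<close>

lemma psi_rec: "of_int (n + 2) * psi (n + 1) = -2 * of_int (2 * n - 1) * psi n"
proof -
  have df: "double_fact (2 * (n + 1) - 3) = of_int (2 * n - 1) * double_fact (2 * n - 3)"
    using double_fact_rec[of "2 * n - 1"] by (simp add: algebra_simps)
  have pow: "(-2 :: complex) powi (n + 1) = -2 * (-2) powi n"
    by (simp add: power_int_add)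
  have fact: "of_int (n + 2) * inverse_fact (n + 1 + 1) = inverse_fact (n + 1)"
    using inverse_fact_rec[of "n + 1"] by (simp add: add.assoc)
  have "of_int (n + 2) * psi (n + 1) = (-2) powi (n + 1) * double_fact (2 * (n + 1) - 3)
      * (of_int (n + 2) * inverse_fact (n + 1 + 1))"
    by (simp only: psi_def mult_ac)
  also have "\<dots> = -2 * of_int (2 * n - 1) * psi n"
    unfolding df pow fact psi_def by (simp only: mult_ac)
  finally show ?thesis .
qed

text \<open>All three terms share the factor \<open>6 * psi (k + l + m - 1)\<close>; the cyclic sum
  of (l - k) m (m - 1) (k + l - 1) that remains is identically zero.\<close>

lemma phi1_d1_d1_d1:
  "of_int (l - k) * phi1 (d1 m) (d (k + l - 1))
      + of_int (m - l) * phi1 (d1 k) (d (l + m - 1)) + of_int (k - m) * phi1 (d1 l) (d (m + k - 1)) = 0"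
proof -
  have s: "m + (k + l - 1) = k + l + m - 1" "k + (l + m - 1) = k + l + m - 1"
    "l + (m + k - 1) = k + l + m - 1" by simp_all
  show ?thesis
    unfolding phi1_values phi1_d1_d_psi s by (simp add: algebra_simps)
qed

lemma phi1_d1_d_d:
  "(of_int (l - k + 1) * phi1 (d1 (k + l + 1)) (d m) + of_int (4 * l - 4 * k + 2) * phi1 (d1 (k + l)) (d m))
      - (of_int (m - l) * phi1 (d1 k) (d (l + m + 1)) + of_int (4 * (m - l)) * phi1 (d1 k) (d (l + m)))
      - (of_int (m - k + 1) * phi1 (d1 (k + m + 1)) (d l) + of_int (4 * m - 4 * k + 2) * phi1 (d1 (k + m)) (d l)) = 0"
proof -
  define s where "s = k + l + m"
  have s: "k + l + 1 + m = s + 1" "k + l + m = s" "k + (l + m + 1) = s + 1" "k + (l + m) = s"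
    "k + m + 1 + l = s + 1" "k + m + l = s"
    by (simp_all add: s_def)
  define K L M :: complex where "K = of_int k" and "L = of_int l" and "M = of_int m"
  have "of_int (s + 2) * psi (s + 1) + 2 * of_int (2 * s - 1) * psi s = 0"
    unfolding psi_rec by (simp add: algebra_simps)
  moreover have "of_int (s + 2) = K + L + M + 2" "of_int (2 * s - 1) = 2 * (K + L + M) - 1"
    by (simp_all add: s_def K_def L_def M_def)
  ultimately have "(K + L + M + 2) * psi (s + 1) + 2 * (2 * (K + L + M) - 1) * psi s = 0"
    by simp
  \<comment> \<open>The cofactor is read off from the coefficient of \<open>psi (s + 1)\<close> in
    the goal, which factors as 6 (L - M) (L M + K^2 - K) (K + L + M + 2). The coefficient of
    \<open>psi s\<close> has the same cofactor.\<close>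
  then have "0 = 6 * (L - M) * (L * M + K^2 - K)
      * ((K + L + M + 2) * psi (s + 1) + 2 * (2 * (K + L + M) - 1) * psi s)"
    by simp
  then show ?thesis
    unfolding phi1_values phi1_d1_d_psi s
    by (simp add: algebra_simps power2_eq_square flip: K_def L_def M_def)
qed

section \<open>The two cocycles, their independence and nontriviality\<close>

lemma two_cocycle_phi1: "Der.two_cocycle phi1"
  by (intro two_cocycle_d1_dI phi1_bilinear phi1_skew phi1_values(3)
      phi1_d1_d1_d1 phi1_d1_d1_d phi1_d1_d_d phi1_d_d_d)

text \<open>This form is -2 times the even part of \<open>phi1\<close>: the unmixed conditions are
  inherited by pulling out -2, and the mixed ones are trivial.\<close>

lemma two_cocycle_phi2: "Der.two_cocycle phi2"
proof (rule two_cocycle_d1_dI[OF phi2_bilinear], unfold phi2_values)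
  fix k l m
  show "-2 * phi1 (d1 k) (d1 l) = - (-2 * phi1 (d1 l) (d1 k))"
    "-2 * phi1 (d k) (d l) = - (-2 * phi1 (d l) (d k))"
    by (simp_all add: phi1_skew[of k l])
  note factor = mult.left_commute[where a = "-2 :: complex"] distrib_left[of "-2 :: complex", symmetric]
    right_diff_distrib[of "-2 :: complex", symmetric]
  show "of_int (l - k) * (-2 * phi1 (d (k + l - 1)) (d m))
      + (of_int (m - l + 1) * (-2 * phi1 (d1 (l + m + 1)) (d1 k)) + of_int (4 * m - 4 * l + 2) * (-2 * phi1 (d1 (l + m)) (d1 k)))
      - (of_int (m - k + 1) * (-2 * phi1 (d1 (k + m + 1)) (d1 l)) + of_int (4 * m - 4 * k + 2) * (-2 * phi1 (d1 (k + m)) (d1 l))) = 0"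
    by (simp only: factor phi1_d1_d1_d mult_zero_right)
  show "(of_int (l - k) * (-2 * phi1 (d (k + l + 1)) (d m)) + of_int (4 * (l - k)) * (-2 * phi1 (d (k + l)) (d m)))
      + (of_int (m - l) * (-2 * phi1 (d (l + m + 1)) (d k)) + of_int (4 * (m - l)) * (-2 * phi1 (d (l + m)) (d k)))
      + (of_int (k - m) * (-2 * phi1 (d (m + k + 1)) (d l)) + of_int (4 * (k - m)) * (-2 * phi1 (d (m + k)) (d l))) = 0"
    by (simp only: factor phi1_d_d_d mult_zero_right)
qed simp_all

theorem proposition10p1:
  shows "Der.two_cocycle phi1 \<and> Der.two_cocycle phi2 \<and>
    (\<forall>\<alpha> \<beta> :: complex. (\<forall>x y. \<alpha> * phi1 x y + \<beta> * phi2 x y = 0) \<longrightarrow> \<alpha> = 0 \<and> \<beta> = 0) \<and>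
    \<not> Der.two_coboundary phi1 \<and> \<not> Der.two_coboundary phi2"
proof (intro conjI two_cocycle_phi1 two_cocycle_phi2 allI impI)
  have vals: "phi1 (d1 0) (d1 1) = 0" "phi1 (d1 (-1)) (d1 2) = 12"
    by (simp_all add: phi1_values kronecker_def)
  \<comment> \<open>\<open>phi2\<close> vanishes on mixed pairs, so one nonzero mixed value of
    \<open>phi1\<close> isolates \<alpha>.\<close>
  have odd: "phi1 (d1 2) (d (-1)) \<noteq> 0"
    by (simp add: phi1_values phi1_d1_d_def inverse_fact_def double_fact_minus_1)
  {
    fix \<alpha> \<beta> :: complex
    assume *: "\<forall>x y. \<alpha> * phi1 x y + \<beta> * phi2 x y = 0"
    show \<alpha>: "\<alpha> = 0"
      using *[rule_format, of "d1 2" "d (-1)"] odd by (simp add: phi2_values)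
    show "\<beta> = 0"
      using *[rule_format, of "d1 (-1)" "d1 2"] by (simp add: phi2_values vals \<alpha>)
  }
  \<comment> \<open>Both pairs have index sum 1, so their brackets are \<open>d 0\<close> and 3
    times \<open>d 0\<close>; a coboundary that vanishes on the first pair also vanishes on the
    second.\<close>
  have not_coboundary: "\<not> Der.two_coboundary \<phi>"
    if "\<phi> (d1 0) (d1 1) = 0" "\<phi> (d1 (-1)) (d1 2) \<noteq> 0" for \<phi>
  proof
    assume "Der.two_coboundary \<phi>"
    then obtain f where f: "Vector_Spaces.linear scale_Der (*) f" "\<phi> = (\<lambda>a b. f (bracket_Der a b))"
      by (auto simp: Der.two_coboundary_def)
    then have "\<phi> (d1 k) (d1 l) = of_int (l - k) * f (d (k + l - 1))" for k l
      by (simp add: bracket_d1_d1 Vector_Spaces.linear_iff)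
    from this[of 0 1] this[of "-1" 2] that show False by simp
  qed
  show "\<not> Der.two_coboundary phi1" "\<not> Der.two_coboundary phi2"
    by (rule not_coboundary; simp add: phi2_values vals)+
qed

end
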